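(* Every $7$-potent ring is commutative; that is, if $R$ is a ring with $x^7=x$ for all $x\in R$, then $R$ is commutative.
   Context: Rings are associative but are not assumed to have a unity. For an integer $n\geq 2$, a ring $R$ is called $n$-potent if $x^n=x$ for all $x\in R$. *)

theory Defs
  imports Main
begin

text \<open>
  The class \<^class>\<open>ring\<close> is that of associative rings without an assumed unity. The
  library power operation requires a \<open>1\<close>, so positive powers are defined here; the
  exponent \<open>0\<close> is deliberately left unspecified.
\<close>

fun pos_power :: "'a::semigroup_mult \<Rightarrow> nat \<Rightarrow> 'a" where
  "pos_power x (Suc 0) = x"
| "pos_power x (Suc (Suc n)) = x * pos_power x (Suc n)"

definition potent_ring :: "nat \<Rightarrow> 'a::ring itself \<Rightarrow> bool" where
  "potent_ring n R \<longleftrightarrow> n \<ge> 2 \<and> (\<forall>x::'a. pos_power x n = x)"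

end

theory Submission
  imports Defs
begin

text \<open>
  A ring with \<open>x^7 = x\<close> is reduced, so its idempotents are central, and \<open>42 x = 0\<close> because
  \<open>(2x)^7 = 2x\<close> gives \<open>126 x = 0\<close>. Since \<open>1 = 21 - 14 - 6\<close>, it suffices that \<open>6u\<close>, \<open>14u\<close> and
  \<open>21u\<close> are central; these are the parts of characteristic 7, 3 and 2.

  In characteristic 7, \<open>s(u) = u + u^2 + \<dots> + u^6\<close> satisfies \<open>u s = s\<close>, hence \<open>s^2 = 6 s\<close>, so
  \<open>6 s\<close> is a central idempotent; \<open>u\<close> is a linear combination of the \<open>s(ku)\<close>. In characteristic 3,
  reducedness gives \<open>u^3 = u\<close>, and \<open>u + u^2\<close> and \<open>u^2 - u\<close> are central. In characteristic 2,
  reducedness gives \<open>u^4 = u\<close>, so \<open>u + u^2\<close> is a central idempotent; linearising, \<open>uv + vu\<close> is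
  central, and commuting it with \<open>u\<close> shows that \<open>u^2\<close>, and hence \<open>u\<close>, is central.
\<close>

definition central :: "'a::ring \<Rightarrow> bool" where
  "central z \<longleftrightarrow> (\<forall>y. z * y = y * z)"

lemma centralD: "central z \<Longrightarrow> z * y = y * z"
  by (simp add: central_def)

lemma central_add: "central x \<Longrightarrow> central y \<Longrightarrow> central (x + y)"
  by (simp add: central_def algebra_simps)

lemma central_diff: "central x \<Longrightarrow> central y \<Longrightarrow> central (x - y)"
  by (simp add: central_def algebra_simps)

lemma central_idempotent:
  fixes e :: "'a::ring"
  assumes reduced: "\<And>x::'a. x * x = 0 \<Longrightarrow> x = 0" and e: "e * e = e"
  shows "central e"
  unfolding central_def
proof
  fix x
  have ee: "e * (e * z) = e * z" for z
    by (metis e mult.assoc)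
  \<comment> \<open>The element starts with \<open>e\<close> and is killed by \<open>e\<close> on
    the right, so its square is zero; the mirror image works for \<open>x * e\<close>.\<close>
  have "e * x - e * x * e = 0"
    by (rule reduced) (simp add: algebra_simps e ee)
  moreover have "x * e - e * x * e = 0"
    by (rule reduced) (simp add: algebra_simps e ee)
  ultimately show "e * x = x * e" by simp
qed

text \<open>Without a unity there is no \<open>of_nat n\<close> in the ring, so integer coefficients
  act by repeated addition.\<close>

primrec nat_mult :: "nat \<Rightarrow> 'a::ring \<Rightarrow> 'a" where
  "nat_mult 0 x = 0"
| "nat_mult (Suc n) x = x + nat_mult n x"

lemma nat_mult_zero: "nat_mult n 0 = 0"
  by (induction n) auto

lemma nat_mult_add: "nat_mult n (x + y) = nat_mult n x + nat_mult n y"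
  by (induction n) (auto simp: algebra_simps)

lemma nat_mult_diff: "nat_mult n (x - y) = nat_mult n x - nat_mult n y"
  by (induction n) (auto simp: algebra_simps)

lemma nat_mult_add_left: "nat_mult (m + n) x = nat_mult m x + nat_mult n x"
  by (induction m) (auto simp: algebra_simps)

lemma nat_mult_nat_mult: "nat_mult m (nat_mult n x) = nat_mult (m * n) x"
  by (induction m) (auto simp: nat_mult_add_left)

lemma mult_nat_mult_left: "nat_mult n x * y = nat_mult n (x * y)"
  by (induction n) (auto simp: algebra_simps)

lemma mult_nat_mult_right: "x * nat_mult n y = nat_mult n (x * y)"
  by (induction n) (auto simp: algebra_simps)

lemma nat_mult_2: "nat_mult 2 x = x + x"
  by (simp add: numeral_2_eq_2)

lemma central_nat_mult: "central x \<Longrightarrow> central (nat_mult n x)"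
  by (simp add: central_def mult_nat_mult_left mult_nat_mult_right)

lemmas nat_mult_simps =
  nat_mult_zero nat_mult_add nat_mult_diff nat_mult_nat_mult mult_nat_mult_left mult_nat_mult_right

lemma nat_mult_mod:
  assumes "nat_mult c x = 0"
  shows "nat_mult n x = nat_mult (n mod c) x"
proof -
  have "nat_mult (n div c * c) x = 0"
    by (simp add: nat_mult_nat_mult[symmetric] assms nat_mult_zero)
  then show ?thesis
    by (metis add_0 div_mult_mod_eq nat_mult_add_left)
qed

locale seven_potent =
  fixes R :: "'a::ring itself"
  assumes power7: "x * (x * (x * (x * (x * (x * x))))) = (x::'a)"
begin

text \<open>Lets the simplifier reduce a seventh power at the head of a longer right-nested product,
  where \<open>power7\<close> does not match.\<close>

lemma power7_mult: "x * (x * (x * (x * (x * (x * (x * y)))))) = x * (y::'a)"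
  by (metis power7 mult.assoc)

lemma reduced: "x * x = 0 \<Longrightarrow> x = (0::'a)"
  using power7[of x] by simp

lemma reduced3: "x * (x * x) = 0 \<Longrightarrow> x = (0::'a)"
  using power7[of x] by simp

lemma idempotent_central: "e * e = e \<Longrightarrow> central (e::'a)"
  using central_idempotent reduced by blast

lemma nat_mult_42: "nat_mult 42 (x::'a) = 0"
proof -
  have "nat_mult 126 z = 0" for z :: 'a
  proof -
    have "nat_mult 126 z + nat_mult 2 z = nat_mult 128 z"
      by (simp add: nat_mult_add_left[symmetric])
    also have "\<dots> = nat_mult 2 z"
      using power7[of "nat_mult 2 z"] by (simp add: nat_mult_simps power7)
    finally show ?thesis by simp
  qed
  \<comment> \<open>\<open>126 * 14 = 42 * 42\<close>, so this says that
    \<open>nat_mult 42 x\<close> has square zero.\<close>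
  from this[of "nat_mult 14 (x * x)"] show ?thesis
    by - (rule reduced, simp add: nat_mult_simps)
qed

lemma nat_mult_mod_42: "nat_mult n (x::'a) = nat_mult (n mod 42) x"
  using nat_mult_mod nat_mult_42 by blast

lemma nat_mult_eq_0: "n mod 42 = 0 \<Longrightarrow> nat_mult n (x::'a) = 0"
  by (subst nat_mult_mod_42) simp

lemma char3_power3: "nat_mult 14 (u * (u * u)) = nat_mult 14 (u::'a)"
proof -
  define w where "w = u * (u * u) - u"
  \<comment> \<open>Modulo 3 the cube of u^3 - u is u^9 - u^3, and u^9 = u^3. The remaining factor 3
    gives 42 together with 14.\<close>
  have "w * (w * w) = nat_mult 3 (u * (u * (u * (u * u))) - u)"
    by (simp add: w_def algebra_simps power7 power7_mult eval_nat_numeral)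
  then have "nat_mult 14 w = 0"
    by - (rule reduced3, simp add: nat_mult_simps nat_mult_eq_0)
  then show ?thesis by (simp add: w_def nat_mult_diff)
qed

lemma char2_power4: "nat_mult 21 (u * (u * (u * u))) = nat_mult 21 (u::'a)"
proof -
  define w where "w = u * (u * (u * u)) - u"
  \<comment> \<open>Modulo 2 the square of u^4 - u is u^8 - u^2, and u^8 = u^2. The remaining factor
    2 gives 42 together with 21.\<close>
  have "w * w = nat_mult 2 (u * u - u * (u * (u * (u * u))))"
    by (simp add: w_def algebra_simps power7_mult eval_nat_numeral)
  then have "nat_mult 21 w = 0"
    by - (rule reduced, simp add: nat_mult_simps nat_mult_eq_0)
  then show ?thesis by (simp add: w_def nat_mult_diff)
qed

definition power_sum :: "'a \<Rightarrow> 'a" where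
  "power_sum u = u + u * u + u * (u * u) + u * (u * (u * u)) + u * (u * (u * (u * u)))
    + u * (u * (u * (u * (u * u))))"

text \<open>Since u^7 = u, multiplication by u permutes the six summands cyclically.\<close>

lemma mult_power_sum: "u * power_sum u = power_sum u"
  by (simp add: power_sum_def algebra_simps power7)

lemma power_sum_square: "power_sum u * power_sum u = nat_mult 6 (power_sum u)"
proof -
  have "power_sum u * z = u * z + u * (u * z) + u * (u * (u * z)) + u * (u * (u * (u * z)))
     + u * (u * (u * (u * (u * z)))) + u * (u * (u * (u * (u * (u * z)))))" for z
    by (simp add: power_sum_def algebra_simps)
  then show ?thesis
    by (simp add: mult_power_sum eval_nat_numeral algebra_simps)
qed

lemma central_power_sum: "central (nat_mult 6 (power_sum u))"
  by (rule idempotent_central)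
    (simp add: nat_mult_simps power_sum_square nat_mult_mod_42[of 216])

lemma central_char7: "central (nat_mult 6 (u::'a))"
proof -
  \<comment> \<open>The weight k^5 makes 6 k^(j+5) the coefficient of u^j. Modulo 7, the sum of
    k^(j+5) over k = 1, ..., 6 is -1 if 6 divides j + 5 and 0 otherwise; for j = 1, ..., 6 only j =
    1 survives, with coefficient -6, which is 36 modulo 42.\<close>
  define s where "s k = nat_mult (k^5) (nat_mult 6 (power_sum (nat_mult k u)))" for k
  have s: "s k = nat_mult (6 * k^6) u + nat_mult (6 * k^7) (u * u) + nat_mult (6 * k^8) (u * (u * u))
      + nat_mult (6 * k^9) (u * (u * (u * u))) + nat_mult (6 * k^10) (u * (u * (u * (u * u))))
      + nat_mult (6 * k^11) (u * (u * (u * (u * (u * u)))))" for k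
    by (simp add: s_def power_sum_def nat_mult_simps power_numeral_reduce ac_simps)
  have "central (s 1 + s 2 + s 3 + s 4 + s 5 + s 6)"
    unfolding s_def by (intro central_add central_nat_mult central_power_sum)
  also have "s 1 + s 2 + s 3 + s 4 + s 5 + s 6 =
      nat_mult (6 * 1^6 + 6 * 2^6 + 6 * 3^6 + 6 * 4^6 + 6 * 5^6 + 6 * 6^6) u
    + nat_mult (6 * 1^7 + 6 * 2^7 + 6 * 3^7 + 6 * 4^7 + 6 * 5^7 + 6 * 6^7) (u * u)
    + nat_mult (6 * 1^8 + 6 * 2^8 + 6 * 3^8 + 6 * 4^8 + 6 * 5^8 + 6 * 6^8) (u * (u * u))
    + nat_mult (6 * 1^9 + 6 * 2^9 + 6 * 3^9 + 6 * 4^9 + 6 * 5^9 + 6 * 6^9) (u * (u * (u * u)))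
    + nat_mult (6 * 1^10 + 6 * 2^10 + 6 * 3^10 + 6 * 4^10 + 6 * 5^10 + 6 * 6^10)
        (u * (u * (u * (u * u))))
    + nat_mult (6 * 1^11 + 6 * 2^11 + 6 * 3^11 + 6 * 4^11 + 6 * 5^11 + 6 * 6^11)
        (u * (u * (u * (u * (u * u)))))"
    unfolding s nat_mult_add_left by (simp only: ac_simps)
  also have "\<dots> = nat_mult 36 u"
    by (simp add: nat_mult_eq_0 nat_mult_mod_42[of 403026])
  finally have "central (nat_mult 6 (nat_mult 36 u))" by (rule central_nat_mult)
  then show ?thesis by (simp add: nat_mult_simps nat_mult_mod_42[of 216])
qed

lemma central_char3: "central (nat_mult 14 (u::'a))"
proof -
  \<comment> \<open>When v^3 = v, the square of v + v^2 is 2(v + v^2). The factor 14, which is -1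
    modulo 3, corrects this to an idempotent: \<open>14 * 14 * 2 = 392\<close> is 14 modulo
    42.\<close>
  have idem: "central (nat_mult 14 (v + v * v))" for v :: 'a
  proof (rule idempotent_central)
    have v3: "nat_mult 14 (v * (v * v)) = nat_mult 14 v" by (rule char3_power3)
    have v4: "nat_mult 14 (v * (v * (v * v))) = nat_mult 14 (v * v)"
      by (metis char3_power3 mult_nat_mult_right)
    have "nat_mult 14 (v + v * v) * nat_mult 14 (v + v * v)
      = nat_mult 14 (nat_mult 14 (v * v) + nat_mult 2 (nat_mult 14 (v * (v * v)))
          + nat_mult 14 (v * (v * (v * v))))"
      by (simp add: nat_mult_simps nat_mult_2 algebra_simps) (simp add: nat_mult_add_left[symmetric])
    also have "\<dots> = nat_mult 392 (v + v * v)"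
      unfolding v3 v4
      by (simp add: nat_mult_simps algebra_simps) (simp add: nat_mult_add_left[symmetric])
    finally show "nat_mult 14 (v + v * v) * nat_mult 14 (v + v * v) = nat_mult 14 (v + v * v)"
      by (simp add: nat_mult_mod_42[of 392])
  qed
  have "central (nat_mult 14 (u + u * u) - nat_mult 14 (- u + - u * - u))"
    by (intro central_diff idem)
  also have "nat_mult 14 (u + u * u) - nat_mult 14 (- u + - u * - u) = nat_mult 14 (nat_mult 2 u)"
    by (simp add: nat_mult_diff[symmetric] nat_mult_2)
  \<comment> \<open>The second doubling undoes the first, as 4 is 1 modulo 3.\<close>
  finally have "central (nat_mult 2 (nat_mult 14 (nat_mult 2 u)))" by (rule central_nat_mult)
  then show ?thesis by (simp add: nat_mult_simps nat_mult_mod_42[of 56])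
qed

lemma central_char2: "central (nat_mult 21 (u::'a))"
proof -
  have idem: "central (nat_mult 21 (v + v * v))" for v :: 'a
  proof (rule idempotent_central)
    \<comment> \<open>The cross term has coefficient \<open>2 * 21 * 21 = 882\<close>, a multiple of
      42, and so vanishes.\<close>
    have "nat_mult 21 (v + v * v) * nat_mult 21 (v + v * v)
      = nat_mult 21 (nat_mult 21 (v * v)) + nat_mult 882 (v * (v * v))
          + nat_mult 21 (nat_mult 21 (v * (v * (v * v))))"
      by (simp add: nat_mult_simps algebra_simps) (simp add: nat_mult_add_left[symmetric])
    also have "\<dots> = nat_mult 441 (v + v * v)"
      unfolding char2_power4 by (simp add: nat_mult_simps nat_mult_eq_0 add.commute)
    finally show "nat_mult 21 (v + v * v) * nat_mult 21 (v + v * v) = nat_mult 21 (v + v * v)"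
      by (simp add: nat_mult_mod_42[of 441])
  qed
  have square: "nat_mult 21 (u * u) * v = v * nat_mult 21 (u * u)" for v
  proof -
    have "central (nat_mult 21 (u + v + (u + v) * (u + v)) - nat_mult 21 (u + u * u)
        - nat_mult 21 (v + v * v))"
      by (intro central_diff idem)
    also have "nat_mult 21 (u + v + (u + v) * (u + v)) - nat_mult 21 (u + u * u)
        - nat_mult 21 (v + v * v) = nat_mult 21 (u * v + v * u)"
      by (simp add: nat_mult_diff[symmetric] algebra_simps)
    \<comment> \<open>Both sides contain uvu; cancelling it leaves vu^2 = u^2 v with the factor
      21.\<close>
    finally have "nat_mult 21 (u * v + v * u) * u = u * nat_mult 21 (u * v + v * u)"
      by (rule centralD)
    then show ?thesis
      by (simp add: nat_mult_simps algebra_simps)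
  qed
  have "central (nat_mult 21 (u + u * u) - nat_mult 21 (u * u))"
    using square by (intro central_diff idem) (simp add: central_def)
  then show ?thesis by (simp add: nat_mult_add)
qed

lemma commutative: "x * y = y * (x::'a)"
proof -
  have "nat_mult 21 x = x + nat_mult 14 x + nat_mult 6 x"
    using nat_mult_add_left[of 1 14 x] nat_mult_add_left[of 15 6 x] by simp
  then have "x = nat_mult 21 x - nat_mult 14 x - nat_mult 6 x" by simp
  also have "central \<dots>"
    by (intro central_diff central_char2 central_char3 central_char7)
  finally show ?thesis by (rule centralD)
qed

end

theorem theorem2p13:
  assumes "potent_ring 7 TYPE('a::ring)"
  shows "\<forall>x y :: 'a. x * y = y * x"
proof -
  interpret seven_potent "TYPE('a)"
    using assms by unfold_locales (simp add: potent_ring_def eval_nat_numeral)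
  show ?thesis using commutative by blast
qed

end
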